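(* Let $\Gamma$ be a countable group and let $\preceq$ be a non-Conradian ordering on $\Gamma$ whose Conradian soul $\Gamma_{\preceq}^{c}$ is non-trivial and admits only finitely many orderings; let $\preceq_1,\ldots,\preceq_{2^k}$ be all of the elements of $\mathcal{O}(\Gamma_{\preceq}^{c})$ (their number is a power of $2$). For $j \in \{1,\ldots,2^k\}$, let $\preceq^j$ be the extension of $\preceq_j$ by $\preceq$. Then at least one of the orderings $\preceq^j$ is an accumulation point (in $\mathcal{O}(\Gamma)$) of its orbit under the conjugacy action of $\Gamma$.
   Context: An ordering on a group $\Gamma$ is a left-invariant total order on $\Gamma$; its positive cone is $P^+_{\preceq}=\{g : g\succ id\}$. $\mathcal{O}(\Gamma)$ denotes the set of all orderings on $\Gamma$, endowed with the topology having as sub-basis the sets $U_{f,g} = \{\preceq \,:\, f \prec g\}$, $f,g \in \Gamma$, $f\neq g$. The group $\Gamma$ acts on $\mathcal{O}(\Gamma)$ by conjugacy (equivalently, by right multiplication): for $f \in \Gamma$, the conjugate $\preceq_f$ of $\preceq$ is defined by $g \preceq_f h$ iff $fgf^{-1} \preceq fhf^{-1}$ (equivalently $gf^{-1} \preceq hf^{-1}$). An ordering $\preceq$ is Conradian if for all $f \succ id$, $g\succ id$ there exists $n\in\mathbb{N}$ with $fg^n\succ g$. A subgroup $\Gamma_*\subset\Gamma$ is $\preceq$-convex if $f\prec h\prec g$ with $f,g\in\Gamma_*$, $h \in \Gamma$, implies $h\in\Gamma_*$; it is $\preceq$-Conradian if the restriction of $\preceq$ to $\Gamma_*$ is Conradian.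 The Conradian soul $\Gamma_{\preceq}^{c}$ is the maximal subgroup of $\Gamma$ that is simultaneously $\preceq$-convex and $\preceq$-Conradian (it exists since convex subgroups are linearly ordered by inclusion). If $\Gamma_*$ is a $\preceq$-convex subgroup and $\preceq_*$ is an ordering on $\Gamma_*$, the extension of $\preceq_*$ by $\preceq$ is the ordering on $\Gamma$ with positive cone $(P^+_{\preceq}\setminus\Gamma_* )\cup P^+_{\preceq_*}$. *)

theory Defs
  imports "HOL-Algebra.Group" "HOL-Analysis.Abstract_Topology"
begin

text \<open>
  An ordering is represented by its reflexive graph: \<^term>\<open>(g, h) \<in> r\<close> means that g precedes
  or equals h. The predicate \<^const>\<open>linear_order_on\<close> forces
  \<^term>\<open>r \<subseteq> carrier G \<times> carrier G\<close>, so an ordering is determined by its values on the carrier.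
\<close>

definition orderings :: "('a, 'b) monoid_scheme \<Rightarrow> 'a rel set" where
  "orderings G =
     {r. linear_order_on (carrier G) r \<and>
         (\<forall>f\<in>carrier G. \<forall>g\<in>carrier G. \<forall>h\<in>carrier G.
            (g, h) \<in> r \<longrightarrow> (f \<otimes>\<^bsub>G\<^esub> g, f \<otimes>\<^bsub>G\<^esub> h) \<in> r)}"

definition olt :: "'a rel \<Rightarrow> 'a \<Rightarrow> 'a \<Rightarrow> bool" where
  "olt r g h \<longleftrightarrow> (g, h) \<in> r \<and> g \<noteq> h"

definition pos_cone :: "('a, 'b) monoid_scheme \<Rightarrow> 'a rel \<Rightarrow> 'a set" where
  "pos_cone G r = {g \<in> carrier G. olt r \<one>\<^bsub>G\<^esub> g}"

text \<open>
  The whole space \<^term>\<open>orderings G\<close> is added to the subbasis as the empty intersection: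
  \<^const>\<open>topology_generated_by\<close> only takes the union of the given sets as the underlying space,
  and for the trivial group there are no pairs of distinct elements.
\<close>

definition orderings_topology :: "('a, 'b) monoid_scheme \<Rightarrow> 'a rel topology" where
  "orderings_topology G =
     topology_generated_by
       (insert (orderings G)
         {{r \<in> orderings G. olt r f g} | f g. f \<in> carrier G \<and> g \<in> carrier G \<and> f \<noteq> g})"

definition conjugate_ordering :: "('a, 'b) monoid_scheme \<Rightarrow> 'a \<Rightarrow> 'a rel \<Rightarrow> 'a rel" where
  "conjugate_ordering G f r =
     {(g, h). g \<in> carrier G \<and> h \<in> carrier G \<and>
        (f \<otimes>\<^bsub>G\<^esub> g \<otimes>\<^bsub>G\<^esub> inv\<^bsub>G\<^esub> f, f \<otimes>\<^bsub>G\<^esub> h \<otimes>\<^bsub>G\<^esub> inv\<^bsub>G\<^esub> f) \<in> r}"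

definition conjugacy_orbit :: "('a, 'b) monoid_scheme \<Rightarrow> 'a rel \<Rightarrow> 'a rel set" where
  "conjugacy_orbit G r = (\<lambda>f. conjugate_ordering G f r) ` carrier G"

text \<open>
  Whether 0 counts as a natural number is immaterial here: if the condition holds with exponent 0,
  then it also holds with exponent 1, by left-invariance.
\<close>

definition conradian :: "('a, 'b) monoid_scheme \<Rightarrow> 'a rel \<Rightarrow> bool" where
  "conradian G r \<longleftrightarrow>
     (\<forall>f\<in>pos_cone G r. \<forall>g\<in>pos_cone G r. \<exists>n::nat. olt r g (f \<otimes>\<^bsub>G\<^esub> (g [^]\<^bsub>G\<^esub> n)))"

definition convex_subgroup :: "('a, 'b) monoid_scheme \<Rightarrow> 'a rel \<Rightarrow> 'a set \<Rightarrow> bool" where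
  "convex_subgroup G r H \<longleftrightarrow>
     subgroup H G \<and>
     (\<forall>f\<in>H. \<forall>g\<in>H. \<forall>h\<in>carrier G. olt r f h \<and> olt r h g \<longrightarrow> h \<in> H)"

definition conradian_subgroup :: "('a, 'b) monoid_scheme \<Rightarrow> 'a rel \<Rightarrow> 'a set \<Rightarrow> bool" where
  "conradian_subgroup G r H \<longleftrightarrow> subgroup H G \<and> conradian (G\<lparr>carrier := H\<rparr>) (Restr r H)"

definition is_conradian_soul :: "('a, 'b) monoid_scheme \<Rightarrow> 'a rel \<Rightarrow> 'a set \<Rightarrow> bool" where
  "is_conradian_soul G r H \<longleftrightarrow>
     convex_subgroup G r H \<and> conradian_subgroup G r H \<and>
     (\<forall>K. convex_subgroup G r K \<and> conradian_subgroup G r K \<and> H \<subseteq> K \<longrightarrow> K = H)"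

definition conradian_soul :: "('a, 'b) monoid_scheme \<Rightarrow> 'a rel \<Rightarrow> 'a set" where
  "conradian_soul G r = (THE H. is_conradian_soul G r H)"

text \<open>
  The left-invariant relation whose positive cone is P.
\<close>

definition ordering_of_cone :: "('a, 'b) monoid_scheme \<Rightarrow> 'a set \<Rightarrow> 'a rel" where
  "ordering_of_cone G P =
     {(g, h). g \<in> carrier G \<and> h \<in> carrier G \<and> (g = h \<or> inv\<^bsub>G\<^esub> g \<otimes>\<^bsub>G\<^esub> h \<in> P)}"

definition extension_ordering ::
  "('a, 'b) monoid_scheme \<Rightarrow> 'a rel \<Rightarrow> 'a set \<Rightarrow> 'a rel \<Rightarrow> 'a rel" where
  "extension_ordering G r H s =
     ordering_of_cone G ((pos_cone G r - H) \<union> pos_cone (G\<lparr>carrier := H\<rparr>) s)"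

text \<open>
  The description in \<^const>\<open>conradian_soul\<close> is well defined: for every ordering there is exactly one
  maximal subgroup that is both convex and Conradian.
\<close>

lemma olt_inv_pos:
  assumes "group G" "r \<in> orderings G" "x \<in> carrier G" "x \<noteq> \<one>\<^bsub>G\<^esub>"
  shows "x \<in> pos_cone G r \<or> inv\<^bsub>G\<^esub> x \<in> pos_cone G r"
proof -
  interpret group G by fact
  have "total_on (carrier G) r"
    and li: "\<And>f g h. \<lbrakk>f \<in> carrier G; g \<in> carrier G; h \<in> carrier G; (g, h) \<in> r\<rbrakk>
      \<Longrightarrow> (f \<otimes>\<^bsub>G\<^esub> g, f \<otimes>\<^bsub>G\<^esub> h) \<in> r"
    using assms(2) by (auto simp: orderings_def linear_order_on_def)
  then consider "(\<one>\<^bsub>G\<^esub>, x) \<in> r" | "(x, \<one>\<^bsub>G\<^esub>) \<in> r"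
    using assms unfolding total_on_def by (metis one_closed)
  then show ?thesis
  proof cases
    case 2
    have "(inv\<^bsub>G\<^esub> x \<otimes>\<^bsub>G\<^esub> x, inv\<^bsub>G\<^esub> x \<otimes>\<^bsub>G\<^esub> \<one>\<^bsub>G\<^esub>) \<in> r"
      using li[of "inv\<^bsub>G\<^esub> x" x "\<one>\<^bsub>G\<^esub>"] 2 assms by simp
    then have "(\<one>\<^bsub>G\<^esub>, inv\<^bsub>G\<^esub> x) \<in> r"
      using assms(3) by simp
    moreover have "\<one>\<^bsub>G\<^esub> \<noteq> inv\<^bsub>G\<^esub> x"
      using assms(3,4) inv_inv inv_one by metis
    ultimately show ?thesis
      using inv_closed[OF assms(3)] unfolding pos_cone_def olt_def by blast
  qed (use assms in \<open>auto simp: pos_cone_def olt_def\<close>)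
qed

lemma convex_subgroups_chain:
  assumes "group G" "r \<in> orderings G" "convex_subgroup G r H" "convex_subgroup G r K"
  shows "H \<subseteq> K \<or> K \<subseteq> H"
proof (rule ccontr)
  assume c: "\<not> ?thesis"
  interpret group G by fact
  have key: "\<exists>p. p \<in> pos_cone G r \<and> p \<in> A \<and> p \<notin> B"
    if "convex_subgroup G r A" "convex_subgroup G r B" "\<not> A \<subseteq> B" for A B
  proof -
    from that obtain x where x: "x \<in> A" "x \<notin> B" by blast
    have A: "subgroup A G" and B: "subgroup B G"
      using that by (auto simp: convex_subgroup_def)
    have xc: "x \<in> carrier G" using A x subgroup.mem_carrier by metis
    have "x \<noteq> \<one>\<^bsub>G\<^esub>" using x B subgroup.one_closed by metis
    moreover have "inv\<^bsub>G\<^esub> x \<in> A" using A x by (simp add: subgroup.m_inv_closed)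
    moreover have "inv\<^bsub>G\<^esub> x \<notin> B" using B x xc subgroup.m_inv_closed inv_inv by metis
    ultimately show ?thesis using olt_inv_pos[OF assms(1,2) xc] x by blast
  qed
  obtain p where p: "p \<in> pos_cone G r" "p \<in> H" "p \<notin> K" using key[OF assms(3,4)] c by blast
  obtain q where q: "q \<in> pos_cone G r" "q \<in> K" "q \<notin> H" using key[OF assms(4,3)] c by blast
  have tot: "total_on (carrier G) r"
    using assms(2) by (auto simp: orderings_def linear_order_on_def)
  have "p \<noteq> q" using p q by blast
  then have "olt r p q \<or> olt r q p"
    using tot p q unfolding total_on_def olt_def pos_cone_def by auto
  moreover have "\<one>\<^bsub>G\<^esub> \<in> H" "\<one>\<^bsub>G\<^esub> \<in> K"
    using assms(3,4) by (auto simp: convex_subgroup_def subgroup.one_closed)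
  ultimately show False
    using assms(3,4) p q unfolding convex_subgroup_def pos_cone_def by blast
qed

lemma ex1_conradian_soul:
  assumes "group G" "r \<in> orderings G"
  shows "\<exists>!H. is_conradian_soul G r H"
proof -
  interpret group G by fact
  define F where "F = {H. convex_subgroup G r H \<and> conradian_subgroup G r H}"
  have asym: "\<not> (olt r x y \<and> olt r y x)" for x y
    using assms(2) by (auto simp: orderings_def order_on_defs olt_def antisym_def)
  have ch: "H \<subseteq> K \<or> K \<subseteq> H" if "H \<in> F" "K \<in> F" for H K
    using convex_subgroups_chain[OF assms] that F_def by blast
  have sub: "subgroup H G" if "H \<in> F" for H using that by (auto simp: F_def convex_subgroup_def)
  have triv: "{\<one>\<^bsub>G\<^esub>} \<in> F"
    unfolding F_def convex_subgroup_def conradian_subgroup_def conradian_def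
    using asym triv_subgroup by (auto simp: pos_cone_def olt_def)
  have common: "\<exists>H\<in>F. x \<in> H \<and> y \<in> H" if "x \<in> \<Union>F" "y \<in> \<Union>F" for x y
    using that ch by (meson UnionE subsetD)
  have subU: "subgroup (\<Union>F) G"
  proof (rule subgroup.intro)
    show "\<Union>F \<subseteq> carrier G" using sub subgroup.subset by blast
    show "\<one>\<^bsub>G\<^esub> \<in> \<Union>F" using triv by blast
    show "x \<otimes>\<^bsub>G\<^esub> y \<in> \<Union>F" if "x \<in> \<Union>F" "y \<in> \<Union>F" for x y
      using common[OF that] sub subgroup.m_closed by fast
    show "inv\<^bsub>G\<^esub> x \<in> \<Union>F" if "x \<in> \<Union>F" for x
      using that sub subgroup.m_inv_closed by fast
  qed
  have convU: "convex_subgroup G r (\<Union>F)"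
    unfolding convex_subgroup_def
  proof (intro conjI subU ballI impI)
    fix f g h assume a: "f \<in> \<Union>F" "g \<in> \<Union>F" "h \<in> carrier G" "olt r f h \<and> olt r h g"
    obtain H where "H \<in> F" "f \<in> H" "g \<in> H" using common[OF a(1,2)] by blast
    then show "h \<in> \<Union>F" using a unfolding F_def convex_subgroup_def by blast
  qed
  have conrU: "conradian_subgroup G r (\<Union>F)"
    unfolding conradian_subgroup_def conradian_def
  proof (intro conjI subU ballI)
    fix f g assume a: "f \<in> pos_cone (G\<lparr>carrier := \<Union>F\<rparr>) (Restr r (\<Union>F))"
      "g \<in> pos_cone (G\<lparr>carrier := \<Union>F\<rparr>) (Restr r (\<Union>F))"
    then have fg: "f \<in> \<Union>F" "g \<in> \<Union>F" by (auto simp: pos_cone_def)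
    obtain H where H: "H \<in> F" "f \<in> H" "g \<in> H" using common[OF fg] by blast
    have "\<one>\<^bsub>G\<^esub> \<in> H" using sub[OF H(1)] subgroup.one_closed by metis
    then have "f \<in> pos_cone (G\<lparr>carrier := H\<rparr>) (Restr r H)" "g \<in> pos_cone (G\<lparr>carrier := H\<rparr>) (Restr r H)"
      using a H by (auto simp: pos_cone_def olt_def)
    moreover have "conradian (G\<lparr>carrier := H\<rparr>) (Restr r H)"
      using H(1) by (simp add: F_def conradian_subgroup_def)
    ultimately obtain n :: nat where
      "olt (Restr r H) g (f \<otimes>\<^bsub>G\<^esub> g [^]\<^bsub>G\<lparr>carrier := H\<rparr>\<^esub> n)"
      unfolding conradian_def by auto
    then have "olt (Restr r (\<Union>F)) g (f \<otimes>\<^bsub>G\<^esub> g [^]\<^bsub>G\<lparr>carrier := \<Union>F\<rparr>\<^esub> n)"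
      using H(1) unfolding olt_def nat_pow_consistent[symmetric] by blast
    then show "\<exists>n::nat. olt (Restr r (\<Union>F)) g
        (f \<otimes>\<^bsub>G\<lparr>carrier := \<Union>F\<rparr>\<^esub> g [^]\<^bsub>G\<lparr>carrier := \<Union>F\<rparr>\<^esub> n)"
      by auto
  qed
  have UF: "\<Union>F \<in> F" using convU conrU by (simp add: F_def)
  have "is_conradian_soul G r (\<Union>F)"
    using convU conrU unfolding is_conradian_soul_def F_def by blast
  moreover have "H = \<Union>F" if "is_conradian_soul G r H" for H
  proof -
    have "H \<in> F" using that by (simp add: is_conradian_soul_def F_def)
    then show ?thesis using that convU conrU unfolding is_conradian_soul_def by blast
  qed
  ultimately show ?thesis by blast
qed

end

(* Let C be the Conradian soul and Q the positive elements outside C. Since C has finitely many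
   orderings, a power of each element of C preserves all of them under conjugation, so every ordering
   of C is Conradian; the same holds for every conjugate of C.

   Claim: for m in Q there are x with C <= xC <= mC and g in Q with x^-1 g x in Q^-1. Otherwise, for
   such x, x^-1 g x is never in Q^-1. If x C x^-1 meets Q, then x C x^-1 is a convex Conradian subgroup
   larger than C. Otherwise x^-1 Q x is contained in Q, x^-1 C x is convex and contains C, so it equals
   C by maximality and x normalizes Q. Hence the convex hull of the powers of m normalizes Q and C,
   which makes it Conradian, again contradicting maximality.

   Taking m minimal modulo C in a finite subset F of Q, the claim gives a conjugate that keeps F
   positive and makes some element of Q negative. By pigeonhole on the restrictions to C, the orbit of
   each extension accumulates at some extension. This relation is transitive, and a serial transitive
   relation on a finite nonempty set has a reflexive point. *)

theory Submission
  imports Defs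
begin

section \<open>Positive cones and conjugation\<close>

text \<open>For a subgroup \<open>C\<close>, these are the strict positive cones of the
  left-invariant total orders on \<open>C\<close>. Product and inverse are those of
  \<open>G\<close>, so cones on different subgroups can be compared directly.\<close>

definition cone_on :: "('a, 'b) monoid_scheme \<Rightarrow> 'a set \<Rightarrow> 'a set \<Rightarrow> bool" where
  "cone_on G C S \<longleftrightarrow> S \<subseteq> C \<and> \<one>\<^bsub>G\<^esub> \<notin> S \<and> (\<forall>x\<in>S. \<forall>y\<in>S. x \<otimes>\<^bsub>G\<^esub> y \<in> S) \<and>
     (\<forall>x\<in>C. x \<noteq> \<one>\<^bsub>G\<^esub> \<longrightarrow> x \<in> S \<or> inv\<^bsub>G\<^esub> x \<in> S)"

text \<open>With the inverse on the left this is a right action, so successive conjugations by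
  \<open>x\<close> and \<open>y\<close> compose to \<open>x \<otimes> y\<close>. The direction is
  opposite to that of \<open>conjugate_ordering\<close>.\<close>

definition (in group) cj :: "'a \<Rightarrow> 'a \<Rightarrow> 'a" where
  "cj x g = inv x \<otimes> g \<otimes> x"

context group
begin

lemma inv_cancel_left [simp]:
  "x \<in> carrier G \<Longrightarrow> y \<in> carrier G \<Longrightarrow> inv x \<otimes> (x \<otimes> y) = y"
  "x \<in> carrier G \<Longrightarrow> y \<in> carrier G \<Longrightarrow> x \<otimes> (inv x \<otimes> y) = y"
  by (simp_all flip: m_assoc)

lemma cj_closed [simp]: "x \<in> carrier G \<Longrightarrow> g \<in> carrier G \<Longrightarrow> cj x g \<in> carrier G"
  by (simp add: cj_def)

lemma cj_mult:
  "x \<in> carrier G \<Longrightarrow> g \<in> carrier G \<Longrightarrow> h \<in> carrier G \<Longrightarrow> cj x (g \<otimes> h) = cj x g \<otimes> cj x h"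
  by (simp add: cj_def m_assoc)

lemma cj_inv: "x \<in> carrier G \<Longrightarrow> g \<in> carrier G \<Longrightarrow> cj x (inv g) = inv (cj x g)"
  by (simp add: cj_def m_assoc inv_mult_group)

lemma cj_one [simp]: "x \<in> carrier G \<Longrightarrow> cj x \<one> = \<one>"
  by (simp add: cj_def)

lemma cj_one_left [simp]: "g \<in> carrier G \<Longrightarrow> cj \<one> g = g"
  by (simp add: cj_def)

lemma cj_cj:
  "x \<in> carrier G \<Longrightarrow> y \<in> carrier G \<Longrightarrow> g \<in> carrier G \<Longrightarrow> cj y (cj x g) = cj (x \<otimes> y) g"
  by (simp add: cj_def m_assoc inv_mult_group)

lemma cj_eq_one_iff: "x \<in> carrier G \<Longrightarrow> g \<in> carrier G \<Longrightarrow> cj x g = \<one> \<longleftrightarrow> g = \<one>"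
proof
  assume "x \<in> carrier G" "g \<in> carrier G" "cj x g = \<one>"
  then have "cj (inv x) (cj x g) = \<one>" by simp
  then show "g = \<one>" using \<open>x \<in> carrier G\<close> \<open>g \<in> carrier G\<close> by (simp add: cj_cj)
qed simp

lemma cj_pow:
  "x \<in> carrier G \<Longrightarrow> g \<in> carrier G \<Longrightarrow> cj x (g [^] (n::nat)) = cj x g [^] n"
  by (induction n) (simp_all add: cj_mult)

text \<open>Conjugation is an injective homomorphism, and cones pull back along such maps.
  \<open>C\<close> and \<open>D\<close> may differ: with \<open>D\<close> the whole group, this
  restricts a conjugated ordering to \<open>C\<close>.\<close>

lemma cone_on_conj:
  assumes C: "subgroup C G" and D: "subgroup D G" and S: "cone_on G D S" and x: "x \<in> carrier G"
    and sub: "\<And>c. c \<in> C \<Longrightarrow> cj x c \<in> D"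
  shows "cone_on G C {c \<in> C. cj x c \<in> S}"
proof -
  have [simp]: "c \<in> carrier G" if "c \<in> C" for c using C that by (rule subgroup.mem_carrier)
  have cl: "a \<otimes> b \<in> C" if "a \<in> C" "b \<in> C" for a b using C that by (rule subgroup.m_closed)
  have ci: "inv a \<in> C" if "a \<in> C" for a using C that by (rule subgroup.m_inv_closed)
  show ?thesis
    using S x sub by (auto simp: cone_on_def cl ci cj_mult cj_inv cj_eq_one_iff)
qed

lemma cone_pow:
  assumes "cone_on G C S" "subgroup C G" "g \<in> S"
  shows "g [^] Suc n \<in> S"
proof (induction n)
  case 0
  have "g \<in> carrier G" using assms by (meson cone_on_def subgroup.mem_carrier subsetD)
  then show ?case using assms by simp
next
  case (Suc n)
  then show ?case using assms by (simp add: cone_on_def)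
qed

text \<open>Conjugation by g permutes the finitely many cones, so some power of g fixes the given one.\<close>

lemma finite_cones_conrad:
  assumes C: "subgroup C G" and fin: "finite {S. cone_on G C S}" and S: "cone_on G C S"
    and f: "f \<in> S" and g: "g \<in> S"
  shows "\<exists>n::nat. inv g \<otimes> f \<otimes> g [^] n \<in> S"
proof -
  have SC: "S \<subseteq> C" using S by (simp add: cone_on_def)
  have CG: "C \<subseteq> carrier G" using C by (rule subgroup.subset)
  have fG [simp]: "f \<in> carrier G" and gG [simp]: "g \<in> carrier G" using f g SC CG by auto
  have gC: "g [^] n \<in> C" for n :: nat
    using g SC C by (induction n) (auto simp: subgroup.one_closed subgroup.m_closed)
  define T where "T n = {c \<in> C. cj (g [^] n) c \<in> S}" for n :: nat
  have "cone_on G C (T n)" for n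
    unfolding T_def
  proof (rule cone_on_conj[OF C C S])
    show "cj (g [^] n) c \<in> C" if "c \<in> C" for c
      using that gC[of n] C by (simp add: cj_def subgroup.m_closed subgroup.m_inv_closed)
  qed simp
  then have "range T \<subseteq> {S. cone_on G C S}" by auto
  then have "finite (range T)" using fin by (rule finite_subset)
  then have "\<not> inj T" using finite_imageD by blast
  then obtain i j where ij: "T i = T j" "i < j"
    unfolding inj_def by (metis linorder_neqE_nat)
  \<comment> \<open>Writing the positive difference \<open>j - i\<close> as \<open>Suc d\<close>
    leaves \<open>d\<close> as the power of \<open>g\<close> that is split off below.\<close>
  define d where "d = j - i - 1"
  have j: "j = i + Suc d" using ij(2) by (simp add: d_def)
  \<comment> \<open>Conjugation by \<open>g [^] i\<close> sends \<open>u\<close> to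
    \<open>f\<close>, so \<open>T i = T j\<close> transfers \<open>f \<in> S\<close> to the
    conjugate of \<open>f\<close> by \<open>g [^] (j - i)\<close>.\<close>
  define u where "u = cj (inv (g [^] i)) f"
  have "f \<in> C" using f SC by blast
  then have "u \<in> C" using gC[of i] C
    by (simp add: u_def cj_def subgroup.m_closed subgroup.m_inv_closed)
  moreover have "cj (g [^] i) u = f" by (simp add: u_def cj_cj)
  ultimately have "u \<in> T j" using f ij(1)[symmetric] by (simp add: T_def)
  then have "cj (g [^] j) u \<in> S" by (simp add: T_def)
  moreover have "cj (g [^] j) u = cj (g [^] Suc d) f"
    unfolding u_def j nat_pow_mult[OF gG, symmetric]
    by (simp add: cj_cj flip: m_assoc)
  ultimately have *: "cj (g [^] Suc d) f \<in> S" by simp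
  have eq: "inv g \<otimes> f \<otimes> g [^] Suc d = g [^] d \<otimes> cj (g [^] Suc d) f"
    unfolding cj_def nat_pow_Suc2[OF gG] by (simp add: m_assoc inv_mult_group)
  have "g [^] d \<otimes> cj (g [^] Suc d) f \<in> S"
  \<comment> \<open>For \<open>d = 0\<close> the factor \<open>g [^] d\<close> is the identity,
    which is outside \<open>S\<close>; closure of the cone covers only positive powers.\<close>
  proof (cases d)
    case 0
    then show ?thesis using * by simp
  next
    case (Suc e)
    then show ?thesis using * cone_pow[OF S C g, of e] S by (simp add: cone_on_def)
  qed
  then show ?thesis using eq by metis
qed

end

section \<open>Orderings and their positive cones\<close>

lemma (in group) olt_iff_pos_cone:
  assumes r: "r \<in> orderings G" and [simp]: "g \<in> carrier G" "h \<in> carrier G"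
  shows "olt r g h \<longleftrightarrow> inv g \<otimes> h \<in> pos_cone G r"
proof -
  have li: "(f \<otimes> a, f \<otimes> b) \<in> r" if "(a, b) \<in> r" "f \<in> carrier G" "a \<in> carrier G" "b \<in> carrier G"
    for f a b using r that by (auto simp: orderings_def)
  have "(inv g \<otimes> g, inv g \<otimes> h) \<in> r \<longleftrightarrow> (g, h) \<in> r"
    using li[of g h "inv g"] li[of "inv g \<otimes> g" "inv g \<otimes> h" g] by auto
  moreover have "\<one> = inv g \<otimes> h \<longleftrightarrow> g = h"
    by (metis assms(2,3) inv_cancel_left(2) inv_closed l_inv r_one)
  ultimately show ?thesis by (simp add: olt_def pos_cone_def)
qed

lemma (in group) pos_cone_cone:
  assumes r: "r \<in> orderings G"
  shows "cone_on G (carrier G) (pos_cone G r)"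
  unfolding cone_on_def
proof (intro conjI ballI impI)
  fix x y assume x: "x \<in> pos_cone G r" and y: "y \<in> pos_cone G r"
  then have [simp]: "x \<in> carrier G" "y \<in> carrier G" by (auto simp: pos_cone_def)
  have 1: "olt r \<one> x" using x by (simp add: pos_cone_def)
  have 2: "olt r x (x \<otimes> y)" using y by (simp add: olt_iff_pos_cone[OF r])
  have "trans r" "antisym r" using r by (auto simp: orderings_def order_on_defs)
  then have "olt r \<one> (x \<otimes> y)"
    using 1 2 unfolding olt_def by (metis antisymD transD)
  then show "x \<otimes> y \<in> pos_cone G r" by (simp add: pos_cone_def)
qed (auto simp: pos_cone_def olt_def dest: olt_inv_pos[OF is_group r, unfolded pos_cone_def olt_def])

lemma (in group) pos_cone_ordering_of_cone:
  assumes "cone_on G (carrier G) P"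
  shows "pos_cone G (ordering_of_cone G P) = P"
  using assms by (auto simp: pos_cone_def olt_def ordering_of_cone_def cone_on_def subset_iff)

lemma (in group) ordering_of_cone_ordering:
  assumes "cone_on G (carrier G) P"
  shows "ordering_of_cone G P \<in> orderings G"
proof -
  have P: "P \<subseteq> carrier G" "\<one> \<notin> P" and mult: "\<And>x y. x \<in> P \<Longrightarrow> y \<in> P \<Longrightarrow> x \<otimes> y \<in> P"
    and tot: "\<And>x. x \<in> carrier G \<Longrightarrow> x \<noteq> \<one> \<Longrightarrow> x \<in> P \<or> inv x \<in> P"
    using assms by (auto simp: cone_on_def)
  have tr: "inv x \<otimes> z \<in> P" if "x \<in> carrier G" "y \<in> carrier G" "z \<in> carrier G"
    "inv x \<otimes> y \<in> P" "inv y \<otimes> z \<in> P" for x y z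
    using mult[OF that(4,5)] that by (simp add: m_assoc)
  have "trans (ordering_of_cone G P)"
    by (rule transI) (auto simp: ordering_of_cone_def intro: tr)
  moreover have "antisym (ordering_of_cone G P)"
  proof (rule antisymI)
    fix x y assume a: "(x, y) \<in> ordering_of_cone G P" "(y, x) \<in> ordering_of_cone G P"
    then show "x = y" using tr[of x y x] P by (auto simp: ordering_of_cone_def)
  qed
  moreover have "total_on (carrier G) (ordering_of_cone G P)"
  proof (rule total_onI)
    fix x y assume [simp]: "x \<in> carrier G" "y \<in> carrier G" and "x \<noteq> y"
    then have "inv x \<otimes> y \<noteq> \<one>" by (metis inv_cancel_left(2) r_one)
    then have "inv x \<otimes> y \<in> P \<or> inv y \<otimes> x \<in> P"
      using tot[of "inv x \<otimes> y"] by (simp add: inv_mult_group)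
    then show "(x, y) \<in> ordering_of_cone G P \<or> (y, x) \<in> ordering_of_cone G P"
      by (auto simp: ordering_of_cone_def)
  qed
  ultimately show ?thesis
    by (auto simp: orderings_def order_on_defs refl_on_def ordering_of_cone_def m_assoc
        inv_mult_group)
qed

lemma (in group) cone_on_subgroup:
  assumes "subgroup C G"
  shows "cone_on (G\<lparr>carrier := C\<rparr>) C S \<longleftrightarrow> cone_on G C S"
  using m_inv_consistent[OF assms] by (auto simp: cone_on_def)

text \<open>\<open>pos_cone\<close> maps the orderings of the subgroup onto its cones, with
  \<open>ordering_of_cone\<close> as a section.\<close>

lemma (in group) finite_cones:
  assumes C: "subgroup C G" and fin: "finite (orderings (G\<lparr>carrier := C\<rparr>))"
  shows "finite {S. cone_on G C S}"
proof (rule finite_subset)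
  interpret H: group "G\<lparr>carrier := C\<rparr>" using C by (rule subgroup_imp_group)
  show "{S. cone_on G C S} \<subseteq> pos_cone (G\<lparr>carrier := C\<rparr>) ` orderings (G\<lparr>carrier := C\<rparr>)"
  proof
    fix S assume "S \<in> {S. cone_on G C S}"
    then have "cone_on (G\<lparr>carrier := C\<rparr>) (carrier (G\<lparr>carrier := C\<rparr>)) S"
      using cone_on_subgroup[OF C] by simp
    then show "S \<in> pos_cone (G\<lparr>carrier := C\<rparr>) ` orderings (G\<lparr>carrier := C\<rparr>)"
      using H.pos_cone_ordering_of_cone H.ordering_of_cone_ordering by (metis imageI)
  qed
qed (use fin in simp)

text \<open>Multiplying the Conrad inequality on the left by \<open>inv g\<close> turns it into
  membership in the cone, the form in which it is established for conjugates and hulls.\<close>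

lemma (in group) conradian_subgroupI:
  assumes r: "r \<in> orderings G" and K: "subgroup K G"
    and ex: "\<And>f g. f \<in> K \<inter> pos_cone G r \<Longrightarrow> g \<in> K \<inter> pos_cone G r \<Longrightarrow>
      \<exists>n::nat. inv g \<otimes> f \<otimes> g [^] n \<in> pos_cone G r"
  shows "conradian_subgroup G r K"
  unfolding conradian_subgroup_def conradian_def
proof (intro conjI K ballI)
  fix f g assume "f \<in> pos_cone (G\<lparr>carrier := K\<rparr>) (Restr r K)"
    "g \<in> pos_cone (G\<lparr>carrier := K\<rparr>) (Restr r K)"
  then have fg: "f \<in> K" "g \<in> K" "olt r \<one> f" "olt r \<one> g"
    by (auto simp: pos_cone_def olt_def)
  then have [simp]: "f \<in> carrier G" "g \<in> carrier G" using K subgroup.mem_carrier by metis+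
  obtain n :: nat where "inv g \<otimes> f \<otimes> g [^] n \<in> pos_cone G r"
    using ex[of f g] fg by (auto simp: pos_cone_def)
  then have "olt r g (f \<otimes> g [^] n)" by (simp add: olt_iff_pos_cone[OF r] m_assoc)
  moreover have "g [^] n \<in> K"
    using fg(2) K by (induction n) (auto simp: subgroup.one_closed subgroup.m_closed)
  ultimately show "\<exists>n::nat. olt (Restr r K) g
        (f \<otimes>\<^bsub>G\<lparr>carrier := K\<rparr>\<^esub> g [^]\<^bsub>G\<lparr>carrier := K\<rparr>\<^esub> n)"
    using fg K by (auto simp: olt_def subgroup.m_closed simp flip: nat_pow_consistent)
qed

section \<open>Invariant orders on the cosets of a subgroup\<close>

text \<open>The model for \<open>Q\<close> is the set of positive elements outside a convex subgroup
  \<open>C\<close>. It encodes a left-invariant total order on the cosets of \<open>C\<close>, in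
  which xC < yC means \<open>inv x \<otimes> y \<in> Q\<close>.\<close>

locale rel_cone = group G for G (structure) +
  fixes C Q
  assumes C: "subgroup C G"
    and QG: "Q \<subseteq> carrier G" and disj: "Q \<inter> C = {}"
    and tricho: "x \<in> carrier G \<Longrightarrow> x \<in> C \<or> x \<in> Q \<or> inv x \<in> Q"
    and QQ: "x \<in> Q \<Longrightarrow> y \<in> Q \<Longrightarrow> x \<otimes> y \<in> Q"
    and CQ: "x \<in> C \<Longrightarrow> y \<in> Q \<Longrightarrow> x \<otimes> y \<in> Q"
    and QC: "x \<in> Q \<Longrightarrow> y \<in> C \<Longrightarrow> x \<otimes> y \<in> Q"
begin

text \<open>The nonnegative part of the coset order: \<open>inv x \<otimes> y \<in> W\<close> means
  xC \<le> yC.\<close>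

definition W where "W = Q \<union> C"

lemma CG: "C \<subseteq> carrier G" using C by (rule subgroup.subset)

lemma memQ [simp]: "x \<in> Q \<Longrightarrow> x \<in> carrier G" using QG by blast
lemma memC [simp]: "x \<in> C \<Longrightarrow> x \<in> carrier G" using CG by blast
lemma memW: "x \<in> W \<Longrightarrow> x \<in> carrier G" by (auto simp: W_def)
lemma C_one [simp]: "\<one> \<in> C" using C by (rule subgroup.one_closed)
lemma C_inv [simp]: "x \<in> C \<Longrightarrow> inv x \<in> C" using C by (rule subgroup.m_inv_closed)
lemma C_mult [simp]: "x \<in> C \<Longrightarrow> y \<in> C \<Longrightarrow> x \<otimes> y \<in> C" using C by (rule subgroup.m_closed)

lemma C_inv_iff: "x \<in> carrier G \<Longrightarrow> inv x \<in> C \<longleftrightarrow> x \<in> C"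
  using C_inv[of x] C_inv[of "inv x"] by auto

lemma QW: "x \<in> Q \<Longrightarrow> y \<in> W \<Longrightarrow> x \<otimes> y \<in> Q" by (auto simp: W_def QQ QC)
lemma WQ: "x \<in> W \<Longrightarrow> y \<in> Q \<Longrightarrow> x \<otimes> y \<in> Q" by (auto simp: W_def QQ CQ)
lemma WW: "x \<in> W \<Longrightarrow> y \<in> W \<Longrightarrow> x \<otimes> y \<in> W" by (auto simp: W_def QQ CQ QC)
lemma Q_W: "x \<in> Q \<Longrightarrow> x \<in> W" by (simp add: W_def)
lemma C_W: "x \<in> C \<Longrightarrow> x \<in> W" by (simp add: W_def)

lemma not_both: "x \<in> Q \<Longrightarrow> inv x \<in> Q \<Longrightarrow> False"
  using QQ[of x "inv x"] disj C_one by auto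

lemma Q_inv_W: "x \<in> Q \<Longrightarrow> inv x \<in> W \<Longrightarrow> False"
  using not_both[of x] C_inv_iff[of x] disj by (auto simp: W_def)

lemma W_or: "x \<in> carrier G \<Longrightarrow> x \<in> W \<or> inv x \<in> Q"
  using tricho by (auto simp: W_def)

lemma WW_C:
  assumes "x \<in> W" "y \<in> W" "x \<otimes> y \<in> C"
  shows "x \<in> C"
  using assms QW[of x y] disj by (auto simp: W_def)

definition rel_convex where
  "rel_convex K \<longleftrightarrow> (\<forall>h\<in>Q. \<forall>k\<in>K. inv h \<otimes> k \<in> Q \<longrightarrow> h \<in> K)"

lemma subgroup_conj:
  assumes x: "x \<in> carrier G"
  shows "subgroup {g \<in> carrier G. cj x g \<in> C} G"
  by unfold_locales (use x in \<open>auto simp: cj_mult cj_inv\<close>)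

text \<open>The subgroup is x C x^-1, and \<open>q\<close> witnesses that it meets \<open>Q\<close>.
  It is convex because, if both factors of a product are sent into \<open>W\<close> and the product
  into \<open>C\<close>, then \<open>WW_C\<close> puts the first image into
  \<open>C\<close>.\<close>

lemma conj_expanding:
  assumes x: "x \<in> carrier G" and sub: "\<And>g. g \<in> Q \<Longrightarrow> cj x g \<in> W"
    and q: "q \<in> Q" "cj x q \<in> C"
  shows "C \<subseteq> {g \<in> carrier G. cj x g \<in> C}" "rel_convex {g \<in> carrier G. cj x g \<in> C}"
proof -
  let ?D = "{g \<in> carrier G. cj x g \<in> C}"
  have D: "subgroup ?D G" using x by (rule subgroup_conj)
  show conv: "rel_convex ?D"
    unfolding rel_convex_def
  proof (intro ballI impI)
    fix h k assume h: "h \<in> Q" and k: "k \<in> ?D" and hk: "inv h \<otimes> k \<in> Q"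
    have "cj x h \<otimes> cj x (inv h \<otimes> k) = cj x k" using x h k by (simp flip: cj_mult)
    then show "h \<in> ?D" using WW_C[OF sub[OF h] sub[OF hk]] k h by auto
  qed
  have qD: "q \<in> ?D" and qqD: "q \<otimes> q \<in> ?D" using q x by (auto simp: cj_mult)
  show "C \<subseteq> ?D"
  proof
    fix a assume a: "a \<in> C"
    \<comment> \<open>The sign of \<open>t\<close> decides which of \<open>inv a \<otimes> q\<close>
      and \<open>a \<otimes> q\<close> lies below \<open>q \<otimes> q\<close>. That element is in
      \<open>Q\<close>, so convexity puts it into \<open>?D\<close>, and cancelling \<open>q\<close>
      leaves \<open>a\<close> or its inverse.\<close>
    define t where "t = inv q \<otimes> a \<otimes> q"
    have [simp]: "q \<in> carrier G" "a \<in> carrier G" using q a by auto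
    have tG: "t \<in> carrier G" by (simp add: t_def)
    have 1: "b \<in> ?D" if b: "b \<in> C" and "inv (b \<otimes> q) \<otimes> (q \<otimes> q) \<in> Q" for b
    proof -
      have bq: "b \<otimes> q \<in> ?D" using conv that CQ[OF b q(1)] qqD unfolding rel_convex_def by blast
      have "b = b \<otimes> q \<otimes> inv q" using b by (simp add: m_assoc)
      then show ?thesis
        using subgroup.m_closed[OF D bq subgroup.m_inv_closed[OF D qD]] by simp
    qed
    from W_or[OF tG] show "a \<in> ?D"
    proof
      assume "t \<in> W"
      then have "t \<otimes> q \<in> Q" using q WQ by simp
      then have "inv (inv a \<otimes> q) \<otimes> (q \<otimes> q) \<in> Q"
        by (simp add: t_def m_assoc inv_mult_group)
      then have "inv a \<in> ?D" using 1[of "inv a"] a by simp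
      then show ?thesis using subgroup.m_inv_closed[OF D, of "inv a"] by simp
    next
      assume "inv t \<in> Q"
      then have "inv t \<otimes> q \<in> Q" using q QQ by simp
      then have "inv (a \<otimes> q) \<otimes> (q \<otimes> q) \<in> Q"
        by (simp add: t_def m_assoc inv_mult_group)
      then show ?thesis using 1 a by simp
    qed
  qed
qed

text \<open>The subgroup is x^-1 C x. Since \<open>cj x\<close> preserves \<open>Q\<close>, it also
  preserves the inverses of \<open>Q\<close>, so whatever it sends into \<open>C\<close> must
  already lie in \<open>C\<close>. Convexity follows in the same way by excluding both signs of
  \<open>u\<close>.\<close>

lemma conj_contracting:
  assumes x: "x \<in> carrier G" and sub: "\<And>g. g \<in> Q \<Longrightarrow> cj x g \<in> Q"
  shows "C \<subseteq> {g \<in> carrier G. cj (inv x) g \<in> C}" "rel_convex {g \<in> carrier G. cj (inv x) g \<in> C}"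
proof -
  have conj_back: "cj x (cj (inv x) g) = g" if "g \<in> carrier G" for g using x that by (simp add: cj_cj)
  show "C \<subseteq> {g \<in> carrier G. cj (inv x) g \<in> C}"
  proof
    fix c assume c: "c \<in> C"
    have "cj (inv x) c \<notin> Q" using sub[of "cj (inv x) c"] conj_back[of c] c disj by auto
    moreover have "inv (cj (inv x) c) \<notin> Q"
    proof
      assume "inv (cj (inv x) c) \<in> Q"
      then have "inv c \<in> Q" using sub[of "inv (cj (inv x) c)"] conj_back[of c] x c by (simp add: cj_inv)
      then show False using c disj C_inv by blast
    qed
    ultimately show "c \<in> {g \<in> carrier G. cj (inv x) g \<in> C}"
      using tricho[of "cj (inv x) c"] x c by auto
  qed
  show "rel_convex {g \<in> carrier G. cj (inv x) g \<in> C}"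
    unfolding rel_convex_def
  proof (intro ballI impI)
    fix h k assume h: "h \<in> Q" and k: "k \<in> {g \<in> carrier G. cj (inv x) g \<in> C}"
      and hk: "inv h \<otimes> k \<in> Q"
    define u where "u = cj (inv x) h"
    define v where "v = cj (inv x) k"
    have uv [simp]: "u \<in> carrier G" "v \<in> carrier G" using x h k by (auto simp: u_def v_def)
    have hh: "cj x u = h" "cj x v = k" using h k by (auto simp: u_def v_def conj_back)
    have "inv u \<notin> Q"
      using sub[of "inv u"] hh x h not_both[of h] by (auto simp: cj_inv)
    moreover have "u \<notin> Q"
    proof
      assume "u \<in> Q"
      then have "inv v \<otimes> u \<in> Q" using k CQ by (simp add: v_def)
      then have "inv k \<otimes> h \<in> Q" using sub[of "inv v \<otimes> u"] hh x by (simp add: cj_mult cj_inv)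
      moreover have "inv (inv h \<otimes> k) = inv k \<otimes> h" using h k by (simp add: inv_mult_group)
      ultimately show False using not_both[OF hk] by simp
    qed
    ultimately show "h \<in> {g \<in> carrier G. cj (inv x) g \<in> C}"
      using tricho[OF uv(1)] h by (auto simp: u_def)
  qed
qed

text \<open>The normalizer of \<open>Q\<close>; the equivalence, rather than one inclusion, makes it
  closed under inverses.\<close>

definition N where "N = {x \<in> carrier G. \<forall>g\<in>carrier G. cj x g \<in> Q \<longleftrightarrow> g \<in> Q}"

lemma memN: "x \<in> N \<Longrightarrow> x \<in> carrier G" by (simp add: N_def)

lemma N_mult: "x \<in> N \<Longrightarrow> y \<in> N \<Longrightarrow> x \<otimes> y \<in> N"
  by (simp add: N_def flip: cj_cj)

lemma N_inv:
  assumes "x \<in> N" shows "inv x \<in> N"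
proof -
  have "cj (inv x) g \<in> Q \<longleftrightarrow> g \<in> Q" if g: "g \<in> carrier G" for g
  proof -
    have "cj x (cj (inv x) g) = g" using g assms by (simp add: N_def cj_cj)
    moreover have "cj x (cj (inv x) g) \<in> Q \<longleftrightarrow> cj (inv x) g \<in> Q"
      using assms g by (simp add: N_def)
    ultimately show ?thesis by simp
  qed
  then show ?thesis using assms by (simp add: N_def)
qed

lemma C_N: "x \<in> C \<Longrightarrow> x \<in> N"
proof -
  have *: "cj x g \<in> Q" if "x \<in> C" "g \<in> Q" for x g using that CQ QC by (simp add: cj_def)
  assume x: "x \<in> C"
  show ?thesis
    unfolding N_def
  proof (intro CollectI conjI ballI iffI)
    show "g \<in> Q" if "g \<in> carrier G" "cj x g \<in> Q" for g
      using *[of "inv x" "cj x g"] that x by (simp add: cj_cj)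
  qed (use x * in auto)
qed

lemma N_pow: "x \<in> N \<Longrightarrow> x [^] (n::nat) \<in> N"
  by (induction n) (auto simp: C_N N_mult)

text \<open>\<open>C\<close> consists of the elements that are neither in \<open>Q\<close> nor
  inverse to an element of \<open>Q\<close>, so whatever normalizes \<open>Q\<close> normalizes
  \<open>C\<close>.\<close>

lemma N_C:
  assumes "x \<in> N" "c \<in> C" shows "cj x c \<in> C"
proof -
  have *: "x \<in> carrier G" using assms by (simp add: N_def)
  have "cj x c \<notin> Q" "cj x (inv c) \<notin> Q" using assms disj C_inv by (auto simp: N_def)
  then show ?thesis using tricho[of "cj x c"] assms * by (auto simp: cj_inv)
qed

lemma N_W: "x \<in> N \<Longrightarrow> w \<in> W \<Longrightarrow> cj x w \<in> W"
  using N_C by (auto simp: N_def W_def)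

section \<open>The convex hull of the powers of one element\<close>

text \<open>Both \<open>h\<close> and \<open>inv h\<close> are bounded by a power of
  \<open>m\<close> in the coset order. This replaces a lower bound by a negative power and makes
  closure under inverses immediate.\<close>

definition between where
  "between m = {h \<in> carrier G. \<exists>n::nat. inv h \<otimes> m [^] n \<in> W \<and> h \<otimes> m [^] n \<in> W}"

lemma C_between: "C \<subseteq> between m"
  by (auto simp: between_def intro!: exI[of _ 0] C_W)

lemma subgroup_between:
  assumes m: "m \<in> N"
  shows "subgroup (between m) G"
proof
  have [simp]: "m \<in> carrier G" using m by (rule memN)
  show "between m \<subseteq> carrier G" by (auto simp: between_def)
  show "\<one> \<in> between m" using C_between[of m] C_one by blast
  show "inv h \<in> between m" if "h \<in> between m" for h using that by (auto simp: between_def)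
  \<comment> \<open>Since \<open>m\<close> normalizes \<open>W\<close>, a factor from
    \<open>W\<close> can be moved past \<open>m [^] p\<close>; the two bounds then multiply and the
    exponents add.\<close>
  have *: "u \<otimes> w \<otimes> m [^] p \<in> W" if "u \<otimes> m [^] p \<in> W" "w \<in> W" "u \<in> carrier G" for u w and p :: nat
  proof -
    have "(u \<otimes> m [^] p) \<otimes> cj (m [^] p) w \<in> W" by (intro WW that N_W N_pow m)
    moreover have "(u \<otimes> m [^] p) \<otimes> cj (m [^] p) w = u \<otimes> w \<otimes> m [^] p"
      using that memW by (simp add: cj_def m_assoc)
    ultimately show ?thesis by simp
  qed
  fix h k assume "h \<in> between m" "k \<in> between m"
  then obtain n p :: nat where n: "inv h \<otimes> m [^] n \<in> W" "h \<otimes> m [^] n \<in> W"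
    and p: "inv k \<otimes> m [^] p \<in> W" "k \<otimes> m [^] p \<in> W" and [simp]: "h \<in> carrier G" "k \<in> carrier G"
    by (auto simp: between_def)
  have "inv k \<otimes> (inv h \<otimes> m [^] n) \<otimes> m [^] p \<in> W" using p(1) n(1) by (rule *) simp
  then have 1: "inv (h \<otimes> k) \<otimes> m [^] (n + p) \<in> W"
    by (simp add: inv_mult_group m_assoc flip: nat_pow_mult)
  have "h \<otimes> (k \<otimes> m [^] p) \<otimes> m [^] n \<in> W" using n(2) p(2) by (rule *) simp
  then have "h \<otimes> k \<otimes> m [^] (n + p) \<in> W"
    by (simp add: m_assoc add.commute[of n] flip: nat_pow_mult)
  with 1 show "h \<otimes> k \<in> between m" by (auto simp: between_def)
qed

lemma Q_pow: "m \<in> Q \<Longrightarrow> m [^] (n::nat) \<in> W"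
  by (induction n) (auto simp: C_W intro: WW Q_W)

lemma between_convex:
  assumes "m \<in> Q"
  shows "rel_convex (between m)"
  unfolding rel_convex_def
proof (intro ballI impI)
  fix h k assume h: "h \<in> Q" and k: "k \<in> between m" and hk: "inv h \<otimes> k \<in> Q"
  obtain n :: nat where n: "inv k \<otimes> m [^] n \<in> W" "k \<in> carrier G" using k by (auto simp: between_def)
  have "inv h \<otimes> m [^] n = (inv h \<otimes> k) \<otimes> (inv k \<otimes> m [^] n)"
    using h n assms by (simp add: m_assoc)
  then have "inv h \<otimes> m [^] n \<in> W" using QW[OF hk n(1)] Q_W by simp
  moreover have "h \<otimes> m [^] n \<in> W" using h Q_pow[OF assms] QW Q_W by blast
  ultimately show "h \<in> between m" using h by (auto simp: between_def)
qed

text \<open>\<open>B\<close> covers the interval from C to mC. An element below a higher power of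
  \<open>m\<close> is brought into this interval by repeated left division by \<open>m\<close>, and
  \<open>N\<close> is a group containing \<open>m\<close>.\<close>

lemma between_N:
  assumes m: "m \<in> Q" and B: "\<And>x. x \<in> W \<Longrightarrow> inv x \<otimes> m \<in> W \<Longrightarrow> x \<in> N"
  shows "between m \<subseteq> N"
proof
  have mN: "m \<in> N" using B[of m] m by (simp add: W_def)
  have *: "h \<in> N" if "h \<in> W" "inv h \<otimes> m [^] n \<in> W" for h and n :: nat
    using that
  proof (induction n arbitrary: h)
    case 0
    \<comment> \<open>With exponent 0 both \<open>h\<close> and \<open>inv h\<close> are
      nonnegative.\<close>
    then have "h \<in> C" using Q_inv_W[of h] memW[of h] by (auto simp: W_def)
    then show ?case by (rule C_N)
  next
    case (Suc n)
    have [simp]: "h \<in> carrier G" using Suc memW by blast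
    show ?case
    proof (cases "inv h \<otimes> m \<in> W")
      case True
      then show ?thesis using B Suc by blast
    next
      case False
      \<comment> \<open>Here mC < hC, so the quotient is still nonnegative and lies below
        \<open>m [^] n\<close>.\<close>
      then have "inv m \<otimes> h \<in> W" using W_or[of "inv h \<otimes> m"] m Q_W by (auto simp: inv_mult_group)
      moreover have "inv (inv m \<otimes> h) \<otimes> m [^] n \<in> W"
        using Suc.prems m by (simp add: inv_mult_group m_assoc flip: nat_pow_Suc2)
      ultimately have "inv m \<otimes> h \<in> N" by (rule Suc.IH)
      then have "m \<otimes> (inv m \<otimes> h) \<in> N" by (rule N_mult[OF mN])
      then show ?thesis using m by simp
    qed
  qed
  fix h assume "h \<in> between m"
  then obtain n :: nat where h: "h \<in> carrier G" "inv h \<otimes> m [^] n \<in> W" "h \<otimes> m [^] n \<in> W"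
    by (auto simp: between_def)
  from W_or[OF h(1)] show "h \<in> N"
  proof
    assume "h \<in> W" then show ?thesis using * h by blast
  next
    assume "inv h \<in> Q"
    then have "inv h \<in> N" using *[of "inv h" n] h Q_W by simp
    then show ?thesis using N_inv h by fastforce
  qed
qed

section \<open>Extended cones, least cosets and accumulation\<close>

lemma cone_union:
  assumes "cone_on G C S"
  shows "cone_on G (carrier G) (Q \<union> S)"
proof -
  have SC: "S \<subseteq> C" using assms by (simp add: cone_on_def)
  show ?thesis
    unfolding cone_on_def
  proof (intro conjI ballI impI)
    show "Q \<union> S \<subseteq> carrier G" using SC CG QG by blast
    show "\<one> \<notin> Q \<union> S" using assms disj C_one by (auto simp: cone_on_def)
    show "x \<otimes> y \<in> Q \<union> S" if "x \<in> Q \<union> S" "y \<in> Q \<union> S" for x y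
    proof (cases "x \<in> Q \<or> y \<in> Q")
      case True
      then show ?thesis using that SC QQ QC CQ by blast
    next
      case False
      then show ?thesis using that assms by (simp add: cone_on_def)
    qed
    show "x \<in> Q \<union> S \<or> inv x \<in> Q \<union> S" if "x \<in> carrier G" "x \<noteq> \<one>" for x
      using tricho[OF that(1)] that(2) assms unfolding cone_on_def by blast
  qed
qed

text \<open>The coset order is total, so a finite nonempty set has an element in a least
  coset.\<close>

lemma exists_minimum:
  assumes "finite F" "F \<noteq> {}" "F \<subseteq> carrier G"
  shows "\<exists>m\<in>F. \<forall>f\<in>F. inv m \<otimes> f \<in> W"
  using assms
proof (induction rule: finite_ne_induct)
  case (singleton x)
  then show ?case by (simp add: C_W)
next
  case (insert x F)
  then obtain m where m: "m \<in> F" "\<forall>f\<in>F. inv m \<otimes> f \<in> W" by auto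
  have [simp]: "x \<in> carrier G" "m \<in> carrier G" using m insert by auto
  show ?case
  proof (cases "inv m \<otimes> x \<in> W")
    case True
    then show ?thesis using m by auto
  next
    case False
    then have xm: "inv x \<otimes> m \<in> W"
      using W_or[of "inv m \<otimes> x"] Q_W by (auto simp: inv_mult_group)
    have "inv x \<otimes> f \<in> W" if "f \<in> F" for f
    proof -
      have "f \<in> carrier G" using that insert by auto
      then have "inv x \<otimes> f = (inv x \<otimes> m) \<otimes> (inv m \<otimes> f)" by (simp add: m_assoc)
      then show ?thesis using WW[OF xm] m that by simp
    qed
    then show ?thesis by (auto simp: C_W)
  qed
qed

text \<open>The ordering with cone \<open>Q \<union> T\<close> is an accumulation point of the orbit of the one with
  cone \<open>Q \<union> S\<close>; the element g, positive for the limit and negative for the conjugate, keeps the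
  two apart.\<close>

definition accum where
  "accum S T \<longleftrightarrow> (\<forall>E. finite E \<and> E \<subseteq> Q \<union> T \<longrightarrow>
     (\<exists>x\<in>carrier G. cj x ` E \<subseteq> Q \<union> S \<and> (\<exists>g\<in>Q \<union> T. inv (cj x g) \<in> Q \<union> S)))"

lemma accum_trans:
  assumes SC: "cone_on G C S" "cone_on G C T" "cone_on G C U"
    and ST: "accum S T" and TU: "accum T U"
  shows "accum S U"
  unfolding accum_def
proof (intro allI impI)
  have cl: "V \<subseteq> carrier G" if "cone_on G C V" for V using that CG by (auto simp: cone_on_def)
  fix E assume E: "finite E \<and> E \<subseteq> Q \<union> U"
  then obtain x g where x: "x \<in> carrier G" "cj x ` E \<subseteq> Q \<union> T"
    and g: "g \<in> Q \<union> U" "inv (cj x g) \<in> Q \<union> T"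
    using TU[unfolded accum_def, rule_format, OF E] by blast
  \<comment> \<open>Adding \<open>inv (cj x g)\<close> to the finite set makes the second
    conjugation keep \<open>g\<close> negative.\<close>
  let ?F = "insert (inv (cj x g)) (cj x ` E)"
  obtain y where y: "y \<in> carrier G" "cj y ` ?F \<subseteq> Q \<union> S"
    using ST[unfolded accum_def, rule_format, of ?F] E x(2) g(2) by blast
  have gG: "g \<in> carrier G" using g cl[OF SC(3)] by auto
  have EG: "e \<in> carrier G" if "e \<in> E" for e using E cl[OF SC(3)] that by auto
  have "cj (x \<otimes> y) e \<in> Q \<union> S" if "e \<in> E" for e
    using y(2) that EG[OF that] x(1) y(1) by (auto simp flip: cj_cj)
  moreover have "inv (cj (x \<otimes> y) g) \<in> Q \<union> S"
    using y x(1) gG by (simp add: cj_inv flip: cj_cj)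
  ultimately show "\<exists>x\<in>carrier G. cj x ` E \<subseteq> Q \<union> S \<and> (\<exists>g\<in>Q \<union> U. inv (cj x g) \<in> Q \<union> S)"
    using x(1) y(1) g(1) by (intro bexI[of _ "x \<otimes> y"]) auto
qed

end

text \<open>For a subgroup containing C, being \<open>rel_convex\<close> means being convex for the ordering with cone
  \<open>Q \<union> S0\<close>, and the last premise of \<open>maximal\<close> is the Conrad property.\<close>

locale soul_cone = rel_cone +
  fixes S0
  assumes fin: "finite {S. cone_on G C S}" and S0: "cone_on G C S0"
    and maximal: "\<lbrakk>subgroup K G; C \<subseteq> K; rel_convex K;
      \<And>f g. f \<in> K \<inter> (Q \<union> S0) \<Longrightarrow> g \<in> K \<inter> (Q \<union> S0) \<Longrightarrow>
        \<exists>n::nat. inv g \<otimes> f \<otimes> g [^] n \<in> Q \<union> S0\<rbrakk> \<Longrightarrow> K = C"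
begin

section \<open>Consequences of the maximality of \<open>C\<close>\<close>

lemma maximal_conj:
  assumes x: "x \<in> carrier G" and sub: "C \<subseteq> {g \<in> carrier G. cj x g \<in> C}" (is "_ \<subseteq> ?D")
    and conv: "rel_convex {g \<in> carrier G. cj x g \<in> C}"
  shows "{g \<in> carrier G. cj x g \<in> C} = C"
proof (rule maximal[OF subgroup_conj[OF x] sub conv])
  fix f g assume f: "f \<in> ?D \<inter> (Q \<union> S0)" and g: "g \<in> ?D \<inter> (Q \<union> S0)"
  then have [simp]: "f \<in> carrier G" "g \<in> carrier G" by auto
  \<comment> \<open>The cone \<open>Q \<union> S0\<close>, restricted to \<open>?D\<close> and
    carried to \<open>C\<close> by \<open>cj x\<close>. On \<open>C\<close> the finiteness of the
    set of cones gives the Conrad property, which is then carried back to \<open>?D\<close>.\<close>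
  define T where "T = {c \<in> C. cj (inv x) c \<in> Q \<union> S0}"
  have conj_back: "cj (inv x) (cj x h) = h" if "h \<in> carrier G" for h using x that by (simp add: cj_cj)
  have T: "cone_on G C T"
    unfolding T_def
    by (rule cone_on_conj[OF C subgroup_self cone_union[OF S0]]) (use x in auto)
  have "cj x f \<in> T" "cj x g \<in> T" using f g by (auto simp: T_def conj_back)
  then obtain n :: nat where "inv (cj x g) \<otimes> cj x f \<otimes> cj x g [^] n \<in> T"
    using finite_cones_conrad[OF C fin T] by blast
  then have "cj x (inv g \<otimes> f \<otimes> g [^] n) \<in> T"
    using x by (simp add: cj_mult cj_inv cj_pow)
  then show "\<exists>n::nat. inv g \<otimes> f \<otimes> g [^] n \<in> Q \<union> S0"
    using conj_back[of "inv g \<otimes> f \<otimes> g [^] n"] by (auto simp: T_def)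
qed

lemma normalizes:
  assumes x: "x \<in> carrier G" and sub: "\<And>g. g \<in> Q \<Longrightarrow> cj x g \<in> W"
  shows "x \<in> N"
proof -
  have subQ: "cj x g \<in> Q" if g: "g \<in> Q" for g
  proof (rule ccontr)
    assume "cj x g \<notin> Q"
    then have c: "cj x g \<in> C" using sub[OF g] by (simp add: W_def)
    \<comment> \<open>If some \<open>g\<close> in \<open>Q\<close> were sent into \<open>C\<close>,
      then x C x^-1 would be a convex Conradian subgroup containing \<open>C\<close> and
      \<open>g\<close>.\<close>
    have "{g \<in> carrier G. cj x g \<in> C} = C"
      by (rule maximal_conj[OF x conj_expanding[OF x sub g c]])
    then show False using g c disj by auto
  qed
  \<comment> \<open>Now x^-1 C x is the candidate; its equality with \<open>C\<close> upgrades the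
    inclusion \<open>subQ\<close> to an equivalence.\<close>
  have eq: "{g \<in> carrier G. cj (inv x) g \<in> C} = C"
    by (rule maximal_conj[OF _ conj_contracting[OF x subQ]]) (use x in auto)
  have "g \<in> Q" if g: "g \<in> carrier G" and cg: "cj x g \<in> Q" for g
  proof -
    have "inv g \<notin> Q" using subQ[of "inv g"] not_both[OF cg] g x by (auto simp: cj_inv)
    moreover have "g \<notin> C"
    proof
      assume "g \<in> C"
      then have "cj x g \<in> {g \<in> carrier G. cj (inv x) g \<in> C}" using x g by (simp add: cj_cj)
      then show False using eq cg disj by auto
    qed
    ultimately show ?thesis using tricho[OF g] by blast
  qed
  then show ?thesis using x subQ unfolding N_def by blast
qed

lemma exists_conj_negative:
  assumes m: "m \<in> Q"
  shows "\<exists>x\<in>W. inv x \<otimes> m \<in> W \<and> (\<exists>g\<in>Q. inv (cj x g) \<in> Q)"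
proof (rule ccontr)
  assume contr: "\<not> ?thesis"
  \<comment> \<open>Under the negated claim no conjugate of \<open>Q\<close> by an element of the
    interval contains a negative element, so \<open>normalizes\<close> applies.\<close>
  have B: "x \<in> N" if x: "x \<in> W" "inv x \<otimes> m \<in> W" for x
  proof (rule normalizes)
    show xG: "x \<in> carrier G" using x memW by blast
    show "cj x g \<in> W" if "g \<in> Q" for g
      using W_or[of "cj x g"] contr x that xG by auto
  qed
  have mN: "m \<in> N" using B[of m] m by (simp add: W_def)
  have "between m = C"
  proof (rule maximal[OF subgroup_between[OF mN] C_between between_convex[OF m]])
    fix f g assume f: "f \<in> between m \<inter> (Q \<union> S0)" and g: "g \<in> between m \<inter> (Q \<union> S0)"
    have SC: "S0 \<subseteq> C" using S0 by (simp add: cone_on_def)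
    have [simp]: "f \<in> carrier G" "g \<in> carrier G" using f g by (auto simp: between_def)
    have gN: "g \<in> N" using between_N[OF m B] g by blast
    show "\<exists>n::nat. inv g \<otimes> f \<otimes> g [^] n \<in> Q \<union> S0"
    proof (cases "f \<in> Q")
      case True
      \<comment> \<open>Exponent 1 yields the conjugate of \<open>f\<close>, which stays in
        \<open>Q\<close>.\<close>
      then have "inv g \<otimes> f \<otimes> g [^] (1::nat) \<in> Q" using gN by (simp add: N_def cj_def)
      then show ?thesis by blast
    next
      case False
      then have fS: "f \<in> S0" using f by blast
      show ?thesis
      proof (cases "g \<in> Q")
        case True
        \<comment> \<open>The conjugate of \<open>f\<close> is only known to be in \<open>C\<close>;
          exponent 2 leaves one further factor \<open>g\<close> from \<open>Q\<close>.\<close>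
        then have "cj g f \<otimes> g \<in> Q" using N_C[OF gN] CQ fS SC by blast
        then have "inv g \<otimes> f \<otimes> g [^] (2::nat) \<in> Q"
          by (simp add: cj_def m_assoc numeral_2_eq_2)
        then show ?thesis by blast
      next
        case False
        then show ?thesis using finite_cones_conrad[OF C fin S0 fS] g by blast
      qed
    qed
  qed
  moreover have "m \<in> between m"
    using m QQ[OF m m] C_one by (auto simp: between_def W_def intro!: exI[of _ 1])
  ultimately show False using m disj by blast
qed

lemma exists_conj_preserving:
  assumes F: "finite F" "F \<subseteq> Q" and ne: "Q \<noteq> {}"
  shows "\<exists>x\<in>carrier G. cj x ` F \<subseteq> Q \<and> (\<exists>g\<in>Q. inv (cj x g) \<in> Q)"
proof -
  obtain q where q: "q \<in> Q" using ne by blast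
  \<comment> \<open>\<open>q\<close> is inserted because \<open>F\<close> may be empty. As xC \<le>
    mC \<le> fC for all \<open>f\<close> in \<open>F\<close>, conjugation by \<open>x\<close> will
    keep \<open>F\<close> in \<open>Q\<close>.\<close>
  obtain m where m: "m \<in> insert q F" "\<forall>f\<in>insert q F. inv m \<otimes> f \<in> W"
    using exists_minimum[of "insert q F"] F q QG by blast
  have mQ: "m \<in> Q" using m q F by blast
  obtain x where x: "x \<in> W" "inv x \<otimes> m \<in> W" and g: "\<exists>g\<in>Q. inv (cj x g) \<in> Q"
    using exists_conj_negative[OF mQ] by blast
  have [simp]: "x \<in> carrier G" using x memW by blast
  have "cj x f \<in> Q" if f: "f \<in> F" for f
  proof -
    have fQ: "f \<in> Q" using f F by blast
    have "inv x \<otimes> f = (inv x \<otimes> m) \<otimes> (inv m \<otimes> f)" using fQ mQ by (simp add: m_assoc)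
    then have w: "inv x \<otimes> f \<in> W" using WW[OF x(2)] m f by simp
    show ?thesis
    proof (cases "x \<in> Q")
      case True
      then show ?thesis using WQ[OF w] by (simp add: cj_def)
    next
      case False
      then have "x \<in> C" using x by (simp add: W_def)
      then show ?thesis using fQ CQ QC by (simp add: cj_def)
    qed
  qed
  then have "cj x ` F \<subseteq> Q" by blast
  then show ?thesis using g \<open>x \<in> carrier G\<close> by blast
qed

section \<open>Accumulation between cones on \<open>C\<close>\<close>

lemma accum_serial:
  assumes ne: "Q \<noteq> {}" and S: "cone_on G C S"
  shows "\<exists>T. cone_on G C T \<and> accum S T"
proof (rule ccontr)
  assume contr: "\<not> ?thesis"
  define bad where "bad T E \<longleftrightarrow> finite E \<and> E \<subseteq> Q \<union> T \<and>
     \<not> (\<exists>x\<in>carrier G. cj x ` E \<subseteq> Q \<union> S \<and> (\<exists>g\<in>Q \<union> T. inv (cj x g) \<in> Q \<union> S))" for T E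
  have "\<exists>E. bad T E" if "cone_on G C T" for T
  proof -
    have "\<not> accum S T" using contr that by blast
    then show ?thesis unfolding accum_def bad_def by simp
  qed
  then obtain E where "\<And>T. cone_on G C T \<Longrightarrow> bad T (E T)" by metis
  then have E: "finite (E T)" "E T \<subseteq> Q \<union> T"
      "\<not> (\<exists>x\<in>carrier G. cj x ` E T \<subseteq> Q \<union> S \<and> (\<exists>g\<in>Q \<union> T. inv (cj x g) \<in> Q \<union> S))"
    if "cone_on G C T" for T
    using that unfolding bad_def by blast+
  \<comment> \<open>The cone \<open>T\<close> induced on \<open>C\<close> by the conjugation is
    known only after \<open>x\<close> is chosen, so \<open>F\<close> collects the
    \<open>Q\<close>-parts of the witnesses of all cones. It is finite because there are finitely
    many cones.\<close>
  define F where "F = (\<Union>T\<in>{T. cone_on G C T}. E T) \<inter> Q"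
  have "finite F" using fin E(1) by (auto simp: F_def)
  then obtain x where x: "x \<in> carrier G" "cj x ` F \<subseteq> Q" and g: "\<exists>g\<in>Q. inv (cj x g) \<in> Q"
    using exists_conj_preserving[of F] ne F_def by blast
  \<comment> \<open>The restriction to \<open>C\<close> of the conjugated ordering: elements of
    \<open>E T\<close> outside \<open>Q\<close> stay positive by the choice of \<open>T\<close>,
    those in \<open>Q\<close> by the choice of \<open>x\<close>.\<close>
  define T where "T = {c \<in> C. cj x c \<in> Q \<union> S}"
  have T: "cone_on G C T"
    unfolding T_def
    by (rule cone_on_conj[OF C subgroup_self cone_union[OF S]]) (use x in auto)
  have "cj x e \<in> Q \<union> S" if "e \<in> E T" for e
  proof (cases "e \<in> Q")
    case True
    then have "e \<in> F" using that T by (auto simp: F_def)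
    then show ?thesis using x by blast
  next
    case False
    then have "e \<in> T" using E(2)[OF T] that by blast
    then show ?thesis by (simp add: T_def)
  qed
  then have "cj x ` E T \<subseteq> Q \<union> S" by blast
  then show False using E(3)[OF T] x(1) g by blast
qed

lemma accum_refl:
  assumes ne: "Q \<noteq> {}"
  shows "\<exists>S. cone_on G C S \<and> accum S S"
proof (rule ccontr)
  assume contr: "\<not> ?thesis"
  define R where "R = {(S, T). cone_on G C S \<and> cone_on G C T \<and> accum S T}"
  have "R \<subseteq> {S. cone_on G C S} \<times> {S. cone_on G C S}" by (auto simp: R_def)
  then have finR: "finite R" using fin finite_subset by blast
  have "trans R" using accum_trans by (auto simp: R_def intro!: transI)
  moreover have "irrefl R" using contr by (auto simp: R_def irrefl_def)
  ultimately have "acyclic R" by (simp add: acyclic_irrefl)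
  \<comment> \<open>A minimal element for the converse is a cone without successor under
    \<open>accum\<close>, contrary to \<open>accum_serial\<close>.\<close>
  then have "wf (R\<inverse>)" using finR by (rule finite_acyclic_wf_converse[rotated])
  then obtain S where S: "cone_on G C S" "\<And>T. (T, S) \<in> R\<inverse> \<Longrightarrow> \<not> cone_on G C T"
    using wfE_min[of "R\<inverse>" S0 "{S. cone_on G C S}"] S0 by auto
  obtain T where "cone_on G C T" "accum S T" using accum_serial[OF ne S(1)] by blast
  moreover from this have "(T, S) \<in> R\<inverse>" using S(1) by (simp add: R_def)
  ultimately show False using S(2) by blast
qed

end

section \<open>Topology and conjugacy in terms of cones\<close>

text \<open>By left-invariance each subbasic condition fixes the sign of the single element
  \<open>inv f \<otimes> g\<close>, so requiring finitely many elements to be positive gives a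
  neighbourhood basis.\<close>

lemma (in group) open_contains_cone_nbhd:
  assumes "openin (orderings_topology G) U" "r \<in> U"
  shows "\<exists>E. finite E \<and> E \<subseteq> pos_cone G r \<and> {s \<in> orderings G. E \<subseteq> pos_cone G s} \<subseteq> U"
proof -
  let ?B = "insert (orderings G)
         {{r \<in> orderings G. olt r f g} | f g. f \<in> carrier G \<and> g \<in> carrier G \<and> f \<noteq> g}"
  have "generate_topology_on ?B U"
    using assms(1) unfolding orderings_topology_def openin_topology_generated_by_iff .
  then show ?thesis using assms(2)
  proof induction
    case Empty
    then show ?case by simp
  next
    case (Int a b)
    then obtain E F where "finite E \<and> E \<subseteq> pos_cone G r \<and> {s \<in> orderings G. E \<subseteq> pos_cone G s} \<subseteq> a"
      "finite F \<and> F \<subseteq> pos_cone G r \<and> {s \<in> orderings G. F \<subseteq> pos_cone G s} \<subseteq> b" by blast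
    then show ?case by (intro exI[of _ "E \<union> F"]) auto
  next
    case (UN K)
    then obtain k where "k \<in> K" "r \<in> k" by blast
    then obtain E where "finite E \<and> E \<subseteq> pos_cone G r \<and> {s \<in> orderings G. E \<subseteq> pos_cone G s} \<subseteq> k"
      using UN.IH[OF \<open>k \<in> K\<close> \<open>r \<in> k\<close>] by (elim exE)
    then show ?case using \<open>k \<in> K\<close> by (intro exI[of _ E]) auto
  next
    case (Basis s)
    then have "s = orderings G \<or>
        (\<exists>f g. f \<in> carrier G \<and> g \<in> carrier G \<and> s = {r \<in> orderings G. olt r f g})" by auto
    then consider "s = orderings G" | f g where "f \<in> carrier G" "g \<in> carrier G"
      "s = {r \<in> orderings G. olt r f g}" by blast
    then show ?case
    proof cases
      case 1
      then show ?thesis by (intro exI[of _ "{}"]) auto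
    next
      case 2
      then show ?thesis using Basis.prems
        by (intro exI[of _ "{inv f \<otimes> g}"]) (auto simp: olt_iff_pos_cone)
    qed
  qed
qed

lemma (in group) conjugate_ordering_of_cone:
  assumes P: "cone_on G (carrier G) P" and x: "x \<in> carrier G"
  shows "conjugate_ordering G (inv x) (ordering_of_cone G P) =
    ordering_of_cone G {g \<in> carrier G. cj x g \<in> P}"
proof -
  have "inv (inv x \<otimes> g \<otimes> inv (inv x)) \<otimes> (inv x \<otimes> h \<otimes> inv (inv x)) = cj x (inv g \<otimes> h)"
    if "g \<in> carrier G" "h \<in> carrier G" for g h
    using that x by (simp add: cj_def inv_mult_group m_assoc)
  moreover have "inv x \<otimes> g \<otimes> inv (inv x) = inv x \<otimes> h \<otimes> inv (inv x) \<longleftrightarrow> g = h"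
    if "g \<in> carrier G" "h \<in> carrier G" for g h
    using that x by simp
  ultimately show ?thesis
    using x by (auto simp: conjugate_ordering_def ordering_of_cone_def)
qed

section \<open>From the Conradian soul to relative cones\<close>

lemma (in group) rel_cone_convex:
  assumes r: "r \<in> orderings G" and H: "convex_subgroup G r H"
  shows "rel_cone G H (pos_cone G r - H)"
proof -
  let ?P = "pos_cone G r"
  have sH: "subgroup H G" using H by (simp add: convex_subgroup_def)
  have P: "cone_on G (carrier G) ?P" using r by (rule pos_cone_cone)
  have PG [simp]: "x \<in> carrier G" if "x \<in> ?P" for x using that by (simp add: pos_cone_def)
  have HG [simp]: "x \<in> carrier G" if "x \<in> H" for x using sH that by (rule subgroup.mem_carrier)
  have H1: "\<one> \<in> H" using sH by (rule subgroup.one_closed)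
  have Hm: "x \<otimes> y \<in> H" if "x \<in> H" "y \<in> H" for x y using sH that by (rule subgroup.m_closed)
  have Hi: "inv x \<in> H" if "x \<in> H" for x using sH that by (rule subgroup.m_inv_closed)
  have mult: "x \<otimes> y \<in> ?P" if "x \<in> ?P" "y \<in> ?P" for x y using P that by (simp add: cone_on_def)
  have tot: "x \<in> ?P \<or> inv x \<in> ?P" if "x \<in> carrier G" "x \<notin> H" for x
  proof -
    have "x \<noteq> \<one>" using that H1 by blast
    then show ?thesis using P that(1) by (simp add: cone_on_def)
  qed
  have conv: "h \<in> H" if "h \<in> ?P" "inv h \<otimes> k \<in> ?P" "k \<in> H" for h k
  proof -
    have "olt r h k" using that by (simp add: olt_iff_pos_cone[OF r])
    moreover have "olt r \<one> h" using that(1) unfolding pos_cone_def by blast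
    ultimately show ?thesis
      using H H1 that(3) PG[OF that(1)] unfolding convex_subgroup_def by blast
  qed
  have nin: "x \<otimes> c \<notin> H" "c \<otimes> x \<notin> H" if "x \<in> ?P - H" "c \<in> H" for x c
    using Hm[of "x \<otimes> c" "inv c"] Hm[of "inv c" "c \<otimes> x"] Hi[of c] that by (auto simp: m_assoc)
  show ?thesis
  proof (intro rel_cone.intro rel_cone_axioms.intro is_group sH)
    show "?P - H \<subseteq> carrier G" by auto
    show "(?P - H) \<inter> H = {}" by auto
    show "x \<in> H \<or> x \<in> ?P - H \<or> inv x \<in> ?P - H" if "x \<in> carrier G" for x
      using tot[OF that] Hi[of "inv x"] that by auto
    show "x \<otimes> y \<in> ?P - H" if x: "x \<in> ?P - H" and y: "y \<in> ?P - H" for x y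
    proof -
      have "x \<otimes> y \<notin> H" using conv[of x "x \<otimes> y"] x y by auto
      then show ?thesis using mult x y by blast
    qed
    show "c \<otimes> y \<in> ?P - H" if c: "c \<in> H" and y: "y \<in> ?P - H" for c y
    proof (rule ccontr)
      assume "c \<otimes> y \<notin> ?P - H"
      \<comment> \<open>Otherwise \<open>y\<close> would lie strictly between the identity and
        \<open>inv c\<close>, and convexity would put it into \<open>H\<close>.\<close>
      then have "inv (c \<otimes> y) \<in> ?P"
        using tot[of "c \<otimes> y"] nin[OF y c] c y by auto
      moreover have "inv (c \<otimes> y) = inv y \<otimes> inv c" using c y by (simp add: inv_mult_group)
      ultimately show False using conv[of y "inv c"] y Hi[OF c] by auto
    qed
    show "x \<otimes> c \<in> ?P - H" if x: "x \<in> ?P - H" and c: "c \<in> H" for x c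
    proof (rule ccontr)
      assume "x \<otimes> c \<notin> ?P - H"
      \<comment> \<open>Here \<open>inv (x \<otimes> c)\<close> itself lies strictly between the
        identity and \<open>inv c\<close>, so it would belong to \<open>H\<close>.\<close>
      then have i: "inv (x \<otimes> c) \<in> ?P"
        using tot[of "x \<otimes> c"] nin[OF x c] c x by auto
      have "inv (x \<otimes> c) \<otimes> x \<in> ?P" using i x mult by blast
      then have "inv c \<in> ?P" using x c by (simp add: inv_mult_group m_assoc)
      moreover have "inv (inv (x \<otimes> c)) \<otimes> inv c = x" using x c by (simp add: m_assoc)
      ultimately have "inv (x \<otimes> c) \<in> H" using conv[of "inv (x \<otimes> c)" "inv c"] i x c Hi by auto
      then show False using Hi[of "inv (x \<otimes> c)"] nin(1)[OF x c] x c by simp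
    qed
  qed
qed

lemma (in group) soul_cone_conradian_soul:
  assumes r: "r \<in> orderings G" and soul: "is_conradian_soul G r H"
    and fin: "finite (orderings (G\<lparr>carrier := H\<rparr>))"
  shows "soul_cone G H (pos_cone G r - H) (pos_cone G r \<inter> H)"
proof -
  define Q where "Q = pos_cone G r - H"
  define S0 where "S0 = pos_cone G r \<inter> H"
  from soul have convH: "convex_subgroup G r H" and H: "subgroup H G"
    unfolding is_conradian_soul_def convex_subgroup_def by blast+
  have P: "cone_on G (carrier G) (pos_cone G r)" using r by (rule pos_cone_cone)
  have QS: "Q \<union> S0 = pos_cone G r" by (auto simp: Q_def S0_def)
  interpret rel_cone G H Q unfolding Q_def by (rule rel_cone_convex[OF r convH])
  show ?thesis
    unfolding Q_def[symmetric] S0_def[symmetric]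
  proof unfold_locales
    show "finite {S. cone_on G H S}" using finite_cones[OF H fin] .
    show "cone_on G H S0" using P by (auto simp: S0_def cone_on_def)
    fix K assume K: "subgroup K G" and HK: "H \<subseteq> K" and conv: "rel_convex K"
      and conr: "\<And>f g. f \<in> K \<inter> (Q \<union> S0) \<Longrightarrow> g \<in> K \<inter> (Q \<union> S0) \<Longrightarrow>
        \<exists>n::nat. inv g \<otimes> f \<otimes> g [^] n \<in> Q \<union> S0"
    have "conradian_subgroup G r K" using conradian_subgroupI[OF r K] conr QS by simp
    moreover have "convex_subgroup G r K"
      unfolding convex_subgroup_def
    proof (intro conjI K ballI impI)
      fix f g h assume f: "f \<in> K" and g: "g \<in> K" and h [simp]: "h \<in> carrier G"
        and o: "olt r f h \<and> olt r h g"
      have [simp]: "f \<in> carrier G" "g \<in> carrier G" using f g K subgroup.mem_carrier by metis+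
      have Km: "x \<otimes> y \<in> K" if "x \<in> K" "y \<in> K" for x y using K that by (rule subgroup.m_closed)
      have Ki: "inv x \<in> K" if "x \<in> K" for x using K that by (rule subgroup.m_inv_closed)
      have 1: "inv f \<otimes> h \<in> Q \<union> S0" and 2: "inv h \<otimes> g \<in> Q \<union> S0"
        using o by (simp_all add: olt_iff_pos_cone[OF r] QS)
      show "h \<in> K"
      \<comment> \<open>\<open>rel_convex\<close> compares elements of \<open>Q\<close> modulo
        \<open>H\<close>. Left translation by \<open>inv f\<close> reduces to it when both
        differences are in \<open>Q\<close>; otherwise one difference is in \<open>H\<close>, hence
        in \<open>K\<close>.\<close>
      proof (cases "inv f \<otimes> h \<in> Q \<and> inv h \<otimes> g \<in> Q")
        case True
        then have "inv (inv f \<otimes> h) \<otimes> (inv f \<otimes> g) \<in> Q" by (simp add: inv_mult_group m_assoc)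
        then have "inv f \<otimes> h \<in> K" using conv True Km[OF Ki[OF f] g] by (auto simp: rel_convex_def)
        then show ?thesis using Km[OF f] by fastforce
      next
        case False
        then have "inv f \<otimes> h \<in> K \<or> inv h \<otimes> g \<in> K" using 1 2 HK by (auto simp: S0_def)
        then show ?thesis
        proof
          assume "inv f \<otimes> h \<in> K"
          then show ?thesis using Km[OF f] by fastforce
        next
          assume "inv h \<otimes> g \<in> K"
          then have "g \<otimes> inv (inv h \<otimes> g) \<in> K" by (rule Km[OF g Ki])
          then show ?thesis by (simp add: inv_mult_group)
        qed
      qed
    qed
    ultimately show "K = H" using soul HK unfolding is_conradian_soul_def by blast
  qed
qed

section \<open>Accumulation in the space of orderings\<close>

lemma (in group) extension_in_derived_set:
  assumes r: "r \<in> orderings G" and nc: "\<not> conradian G r" and soul: "is_conradian_soul G r H"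
    and fin: "finite (orderings (G\<lparr>carrier := H\<rparr>))"
  shows "\<exists>s \<in> orderings (G\<lparr>carrier := H\<rparr>). extension_ordering G r H s \<in>
    orderings_topology G derived_set_of conjugacy_orbit G (extension_ordering G r H s)"
proof -
  define Q where "Q = pos_cone G r - H"
  interpret soul_cone G H Q "pos_cone G r \<inter> H"
    unfolding Q_def using r soul fin by (rule soul_cone_conradian_soul)
  \<comment> \<open>Without such elements the soul would be the whole group and \<open>r\<close>
    would be Conradian.\<close>
  have "Q \<noteq> {}"
  proof
    assume "Q = {}"
    then have "H = carrier G" using tricho CG by auto
    then have "conradian (G\<lparr>carrier := carrier G\<rparr>) (Restr r (carrier G))"
      using soul unfolding is_conradian_soul_def conradian_subgroup_def by blast
    moreover have "Restr r (carrier G) = r"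
      using r by (auto simp: orderings_def order_on_defs)
    ultimately show False using nc by simp
  qed
  then obtain S where S: "cone_on G H S" "accum S S" using accum_refl by blast
  let ?H = "G\<lparr>carrier := H\<rparr>"
  interpret GH: group ?H using C by (rule subgroup_imp_group)
  have S': "cone_on ?H (carrier ?H) S" using S cone_on_subgroup[OF C] by simp
  define s where "s = ordering_of_cone ?H S"
  have s: "s \<in> orderings ?H" unfolding s_def using S' by (rule GH.ordering_of_cone_ordering)
  define e where "e = extension_ordering G r H s"
  have e: "e = ordering_of_cone G (Q \<union> S)"
    by (simp add: e_def extension_ordering_def Q_def s_def GH.pos_cone_ordering_of_cone[OF S'])
  have PS: "cone_on G (carrier G) (Q \<union> S)" using S(1) by (rule cone_union)
  have eo: "e \<in> orderings G" unfolding e using PS by (rule ordering_of_cone_ordering)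
  have pe: "pos_cone G e = Q \<union> S" unfolding e using PS by (rule pos_cone_ordering_of_cone)
  have "e \<in> orderings_topology G derived_set_of conjugacy_orbit G e"
    unfolding in_derived_set_of
  proof (intro conjI allI impI)
    show "e \<in> topspace (orderings_topology G)"
      using eo by (auto simp: orderings_topology_def)
    fix U assume U: "e \<in> U \<and> openin (orderings_topology G) U"
    then obtain E where E: "finite E" "E \<subseteq> Q \<union> S" "{s \<in> orderings G. E \<subseteq> pos_cone G s} \<subseteq> U"
      using open_contains_cone_nbhd[of U e] pe by auto
    obtain x g where x: "x \<in> carrier G" "cj x ` E \<subseteq> Q \<union> S"
      and g: "g \<in> Q \<union> S" "inv (cj x g) \<in> Q \<union> S"
      using S(2)[unfolded accum_def, rule_format, of E] E by blast
    define D where "D = {g \<in> carrier G. cj x g \<in> Q \<union> S}"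
    have D: "cone_on G (carrier G) D"
      unfolding D_def by (rule cone_on_conj[OF subgroup_self subgroup_self PS]) (use x in auto)
    \<comment> \<open>Conjugating by \<open>inv x\<close> matches the direction of
      \<open>cj x\<close>, so the positive cone of \<open>e'\<close> is \<open>D\<close>.\<close>
    define e' where "e' = conjugate_ordering G (inv x) e"
    have e': "e' = ordering_of_cone G D"
      unfolding e'_def e D_def by (rule conjugate_ordering_of_cone[OF PS x(1)])
    have pe': "pos_cone G e' = D" unfolding e' using D by (rule pos_cone_ordering_of_cone)
    have "E \<subseteq> D" using E(2) x PS by (auto simp: D_def cone_on_def)
    then have "e' \<in> U"
      using E(3) pe' ordering_of_cone_ordering[OF D] e' by auto
    moreover have "e' \<in> conjugacy_orbit G e" using x by (auto simp: conjugacy_orbit_def e'_def)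
    \<comment> \<open>\<open>g\<close> is positive for \<open>e\<close>, while its inverse is
      positive for \<open>e'\<close>; equality would put an element and its inverse into one
      cone.\<close>
    moreover have "e' \<noteq> e"
    proof
      assume "e' = e"
      then have "cj x g \<in> Q \<union> S" using pe pe' g by (auto simp: D_def)
      then have "cj x g \<otimes> inv (cj x g) \<in> Q \<union> S" using g PS by (simp only: cone_on_def)
      moreover have "g \<in> carrier G" using g PS by (auto simp: cone_on_def)
      ultimately show False using x PS by (simp add: cone_on_def)
    qed
    ultimately show "\<exists>y. y \<noteq> e \<and> y \<in> conjugacy_orbit G e \<and> y \<in> U" by blast
  qed
  then show ?thesis using s unfolding e_def by blast
qed

theorem proposition4p9:
  fixes G :: "('a, 'b) monoid_scheme" and r :: "'a rel"
  assumes "group G"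
    and "countable (carrier G)"
    and "r \<in> orderings G"
    and "\<not> conradian G r"
    and "conradian_soul G r \<noteq> {\<one>\<^bsub>G\<^esub>}"
    and "finite (orderings (G\<lparr>carrier := conradian_soul G r\<rparr>))"
  shows "\<exists>s \<in> orderings (G\<lparr>carrier := conradian_soul G r\<rparr>).
           extension_ordering G r (conradian_soul G r) s \<in>
             orderings_topology G derived_set_of
               conjugacy_orbit G (extension_ordering G r (conradian_soul G r) s)"
proof -
  interpret group G by fact
  have "is_conradian_soul G r (conradian_soul G r)"
    unfolding conradian_soul_def by (rule theI'[OF ex1_conradian_soul[OF assms(1,3)]])
  then show ?thesis using assms(3,4,6) by (intro extension_in_derived_set)
qed

end
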